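(* Assume that $$\partial_r\bar p_-(r)=\frac1r\bar\rho_-(r)\bar w_-^2(r)$$ and $$\bar p_+=\big((1+\mu^2)\overline M_-^2-\mu^2\big)\bar p_-,\quad \bar q_+=\mu^2\Big(\bar q_-+\frac{2}{\gamma-1}\frac{\bar c_-^2}{\bar q_-}\Big),\quad \bar\rho_+=\frac{\bar\rho_-\bar q_-}{\bar q_+},\quad \bar w_+=\bar w_-$$ hold. Then for given $C^7$-functions $(\bar w_-(r),\bar q_-(r))$, the state $\overline U_+(r)$ satisfies $$\partial_r\bar p_+(r)=\frac1r\bar\rho_+(r)\bar w_+^2(r)$$ if and only if $\frac{1}{\overline M_-^2(r)}$ satisfies $$\partial_r\Big(\frac1{\overline M_-^2(r)}\Big)=\frac{\gamma-1}{4\bar q_-^2(r)}\frac{\bar w_-^2(r)}{r}\left(\frac{(\gamma+1)^2}{\gamma-1+\frac{2}{\overline M_-^2(r)}}-\Big(\gamma-1+\frac{2}{\overline M_-^2(r)}\Big)\right).$$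
   Context: Constants: $\gamma>1$, $A>0$, $c_v>0$, $\mu^2=\frac{\gamma-1}{\gamma+1}$. The states $\overline U_\pm(r)=(\bar p_\pm,0,\bar w_\pm,\bar q_\pm,\bar s_\pm)^\top$ are functions of $r\in(0,r_0)$: pressure, (zero) flow angle, swirl velocity, speed modulo swirl, entropy, with positive pressure, density and $\bar q_\pm$. The density $\bar\rho_\pm$ is given by $\bar p_\pm=Ae^{\bar s_\pm/c_v}\bar\rho_\pm^\gamma$, $\bar c_-^2=\gamma\bar p_-/\bar\rho_-$, $\overline M_-^2=\bar q_-^2/\bar c_-^2$. *)

theory Defs
  imports Complex_Main
begin

(* C^k regularity on an open set: every function in the chain of derivatives is a two-sided
   derivative at each point of S, so the notion is only meant for open S. *)
primrec C_k_on :: "nat \<Rightarrow> (real \<Rightarrow> real) \<Rightarrow> real set \<Rightarrow> bool" where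
  "C_k_on 0 f S \<longleftrightarrow> continuous_on S f"
| "C_k_on (Suc k) f S \<longleftrightarrow>
     (\<exists>f'. (\<forall>x\<in>S. (f has_real_derivative f' x) (at x)) \<and> C_k_on k f' S)"

(* The state vector (p, theta, w, q, s); q is the speed modulo swirl. *)
record flow_state =
  pressure :: real
  flow_angle :: real
  swirl :: real
  speed :: real
  entropy :: real

(* For positive pressure and density the last conjunct determines rho from U. *)
definition background_state ::
  "real \<Rightarrow> real \<Rightarrow> real \<Rightarrow> real \<Rightarrow> (real \<Rightarrow> flow_state) \<Rightarrow> (real \<Rightarrow> real) \<Rightarrow> bool" where
  "background_state \<gamma> A c\<^sub>v r\<^sub>0 U \<rho> \<longleftrightarrow>
     (\<forall>r\<in>{0<..<r\<^sub>0}.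
        flow_angle (U r) = 0 \<and> pressure (U r) > 0 \<and> \<rho> r > 0 \<and> speed (U r) > 0 \<and>
        pressure (U r) = A * exp (entropy (U r) / c\<^sub>v) * \<rho> r powr \<gamma>)"

definition sound_speed_sq :: "real \<Rightarrow> flow_state \<Rightarrow> real \<Rightarrow> real" where
  "sound_speed_sq \<gamma> u \<rho> = \<gamma> * pressure u / \<rho>"

definition mach_sq :: "real \<Rightarrow> flow_state \<Rightarrow> real \<Rightarrow> real" where
  "mach_sq \<gamma> u \<rho> = (speed u)\<^sup>2 / sound_speed_sq \<gamma> u \<rho>"

definition mu_sq :: "real \<Rightarrow> real" where
  "mu_sq \<gamma> = (\<gamma> - 1) / (\<gamma> + 1)"

end

theory Submission
  imports Defs
begin

text \<open>
  Write \<open>X\<close> for the reciprocal of the squared Mach number ahead of the shock, \<open>a\<close> for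
  \<open>1 + \<mu>\<^sup>2 = 2 * \<gamma> / (\<gamma> + 1)\<close> and \<open>D\<close> for \<open>\<gamma> - 1 + 2 * X\<close>. The jump conditions become
  \<open>p\<^sub>+ = (a / X - \<mu>\<^sup>2) * p\<^sub>-\<close> and \<open>\<rho>\<^sub>+ = (\<gamma> + 1) * \<rho>\<^sub>- / D\<close>. The relation between \<open>p\<^sub>+\<close> and \<open>X\<close>
  can be solved for \<open>X\<close>, so, \<open>p\<^sub>-\<close> being differentiable, \<open>p\<^sub>+\<close> is differentiable at a point
  exactly when \<open>X\<close> is, and each derivative determines the other
  (\<open>has_real_derivative_jump_iff\<close>). It remains to insert the derivative of \<open>p\<^sub>-\<close> and
  \<open>p\<^sub>- = \<rho>\<^sub>- * q\<^sub>-\<^sup>2 * X / \<gamma>\<close>: the value of \<open>X'\<close> in the claim then corresponds to the derivative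
  \<open>\<rho>\<^sub>+ * w\<^sup>2 / r\<close> of \<open>p\<^sub>+\<close> (\<open>jump_derivative_identity\<close>). Both equivalences hold at each radius
  separately.
\<close>

text \<open>
  The direction from left to right uses \<open>X = a * P / (Q + b * P)\<close>, where the denominator is
  \<open>a * P / X\<close> and hence nonzero.
\<close>
lemma has_real_derivative_jump_iff:
  fixes P Q X :: "real \<Rightarrow> real" and a b P' E :: real
  assumes S: "open S" "r \<in> S"
    and P: "(P has_real_derivative P') (at r)"
    and nz: "a \<noteq> 0" "\<And>x. x \<in> S \<Longrightarrow> P x \<noteq> 0" "\<And>x. x \<in> S \<Longrightarrow> X x \<noteq> 0"
    and Q: "\<And>x. x \<in> S \<Longrightarrow> Q x = (a / X x - b) * P x"
  shows "(Q has_real_derivative (a / X r - b) * P' - a * P r * E / (X r)\<^sup>2) (at r)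
    \<longleftrightarrow> (X has_real_derivative E) (at r)"
proof
  let ?D = "(a / X r - b) * P' - a * P r * E / (X r)\<^sup>2"
  have den: "Q x + b * P x = a * P x / X x" if "x \<in> S" for x
    using Q[OF that] by (simp add: algebra_simps)
  have den0: "Q r + b * P r \<noteq> 0"
    using den[OF S(2)] nz(1) nz(2)[OF S(2)] nz(3)[OF S(2)] by simp
  assume "(Q has_real_derivative ?D) (at r)"
  with P den0 have "((\<lambda>x. a * P x / (Q x + b * P x)) has_real_derivative
      (a * P' * (Q r + b * P r) - a * P r * (?D + b * P'))
        / ((Q r + b * P r) * (Q r + b * P r))) (at r)"
    by (auto intro!: derivative_eq_intros)
  also have "(a * P' * (Q r + b * P r) - a * P r * (?D + b * P'))
        / ((Q r + b * P r) * (Q r + b * P r)) = E"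
    unfolding den[OF S(2)] using nz(1) nz(2)[OF S(2)] nz(3)[OF S(2)]
    by (simp add: field_simps power2_eq_square)
  finally show "(X has_real_derivative E) (at r)"
    by (rule has_field_derivative_transform_within_open[OF _ S]) (simp add: den nz)
next
  assume "(X has_real_derivative E) (at r)"
  with P have "((\<lambda>x. (a / X x - b) * P x) has_real_derivative
      (a / X r - b) * P' - a * P r * E / (X r)\<^sup>2) (at r)"
    using nz(3)[OF S(2)]
    by (auto intro!: derivative_eq_intros simp: power2_eq_square)
  then show "(Q has_real_derivative (a / X r - b) * P' - a * P r * E / (X r)\<^sup>2) (at r)"
    by (rule has_field_derivative_transform_within_open[OF _ S]) (simp add: Q)
qed

text \<open>
  Here \<open>x\<close> is the reciprocal squared Mach number, \<open>p\<close>, \<open>\<rho>\<close> and \<open>q\<close> are pressure, density and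
  speed ahead of the shock, and \<open>k\<close> stands for \<open>w\<^sup>2 / r\<close>. Both sides are
  multiples of \<open>\<rho> * k\<close>, and the identity between the cofactors involves only \<open>\<gamma>\<close> and \<open>x\<close>.
\<close>
lemma jump_derivative_identity:
  fixes \<gamma> x p \<rho> q k :: real
  assumes "\<gamma> > 1" "x > 0" "q > 0" and p: "p = \<rho> * q\<^sup>2 * x / \<gamma>"
  defines "D \<equiv> \<gamma> - 1 + 2 * x"
  shows "((1 + mu_sq \<gamma>) / x - mu_sq \<gamma>) * (\<rho> * k)
      - (1 + mu_sq \<gamma>) * p * ((\<gamma> - 1) / (4 * q\<^sup>2) * k * ((\<gamma> + 1)\<^sup>2 / D - D)) / x\<^sup>2
    = k * (\<rho> * (\<gamma> + 1) / D)"
proof -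
  have D: "D > 0" and x: "x = (D - (\<gamma> - 1)) / 2"
    using assms by (simp_all add: D_def)
  have mu: "1 + mu_sq \<gamma> = 2 * \<gamma> / (\<gamma> + 1)"
    using assms(1) by (simp add: mu_sq_def field_simps)
  have pE: "(1 + mu_sq \<gamma>) * p * ((\<gamma> - 1) / (4 * q\<^sup>2) * k * ((\<gamma> + 1)\<^sup>2 / D - D)) / x\<^sup>2
      = \<rho> * k * ((\<gamma> - 1) / (2 * (\<gamma> + 1) * x) * ((\<gamma> + 1)\<^sup>2 / D - D))"
    unfolding mu p using assms(1-3) by (simp add: divide_simps power2_eq_square)
  have "(1 + mu_sq \<gamma>) / x - mu_sq \<gamma>
      - (\<gamma> - 1) / (2 * (\<gamma> + 1) * x) * ((\<gamma> + 1)\<^sup>2 / D - D) = (\<gamma> + 1) / D"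
  proof -
    have "4 * \<gamma> * D - 2 * (\<gamma> - 1) * x * D - (\<gamma> - 1) * ((\<gamma> + 1)\<^sup>2 - D\<^sup>2)
        = 2 * (\<gamma> + 1)\<^sup>2 * x"
      unfolding x by (simp add: field_simps power2_eq_square)
    moreover have "(1 + mu_sq \<gamma>) / x - mu_sq \<gamma>
        - (\<gamma> - 1) / (2 * (\<gamma> + 1) * x) * ((\<gamma> + 1)\<^sup>2 / D - D)
      = (4 * \<gamma> * D - 2 * (\<gamma> - 1) * x * D - (\<gamma> - 1) * ((\<gamma> + 1)\<^sup>2 - D\<^sup>2))
        / (2 * (\<gamma> + 1) * x * D)"
      unfolding mu mu_sq_def using assms(1,2) D
      by (simp add: divide_simps) (simp add: algebra_simps power2_eq_square)
    ultimately show ?thesis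
      using assms(1,2) D by (simp add: divide_simps power2_eq_square)
  qed
  then have "\<rho> * k * ((1 + mu_sq \<gamma>) / x - mu_sq \<gamma>
      - (\<gamma> - 1) / (2 * (\<gamma> + 1) * x) * ((\<gamma> + 1)\<^sup>2 / D - D)) = \<rho> * k * ((\<gamma> + 1) / D)"
    by simp
  then show ?thesis
    unfolding pE by (simp add: algebra_simps)
qed

theorem lemma2p5:
  fixes \<gamma> A c\<^sub>v r\<^sub>0 :: real
    and U\<^sub>m U\<^sub>p :: "real \<Rightarrow> flow_state"
    and \<rho>\<^sub>m \<rho>\<^sub>p :: "real \<Rightarrow> real"
  assumes "\<gamma> > 1" and "A > 0" and "c\<^sub>v > 0" and "r\<^sub>0 > 0"
    and "background_state \<gamma> A c\<^sub>v r\<^sub>0 U\<^sub>m \<rho>\<^sub>m"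
    and "background_state \<gamma> A c\<^sub>v r\<^sub>0 U\<^sub>p \<rho>\<^sub>p"
    and "C_k_on 7 (\<lambda>r. swirl (U\<^sub>m r)) {0<..<r\<^sub>0}"
    and "C_k_on 7 (\<lambda>r. speed (U\<^sub>m r)) {0<..<r\<^sub>0}"
    and "\<forall>r\<in>{0<..<r\<^sub>0}. ((\<lambda>r. pressure (U\<^sub>m r)) has_real_derivative
           1 / r * \<rho>\<^sub>m r * (swirl (U\<^sub>m r))\<^sup>2) (at r)"
    and "\<forall>r\<in>{0<..<r\<^sub>0}. pressure (U\<^sub>p r) =
           ((1 + mu_sq \<gamma>) * mach_sq \<gamma> (U\<^sub>m r) (\<rho>\<^sub>m r) - mu_sq \<gamma>) * pressure (U\<^sub>m r)"
    and "\<forall>r\<in>{0<..<r\<^sub>0}. speed (U\<^sub>p r) =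
           mu_sq \<gamma> * (speed (U\<^sub>m r)
             + 2 / (\<gamma> - 1) * (sound_speed_sq \<gamma> (U\<^sub>m r) (\<rho>\<^sub>m r) / speed (U\<^sub>m r)))"
    and "\<forall>r\<in>{0<..<r\<^sub>0}. \<rho>\<^sub>p r = \<rho>\<^sub>m r * speed (U\<^sub>m r) / speed (U\<^sub>p r)"
    and "\<forall>r\<in>{0<..<r\<^sub>0}. swirl (U\<^sub>p r) = swirl (U\<^sub>m r)"
  shows "(\<forall>r\<in>{0<..<r\<^sub>0}. ((\<lambda>r. pressure (U\<^sub>p r)) has_real_derivative
            1 / r * \<rho>\<^sub>p r * (swirl (U\<^sub>p r))\<^sup>2) (at r))
     \<longleftrightarrow>
         (\<forall>r\<in>{0<..<r\<^sub>0}. ((\<lambda>r. 1 / mach_sq \<gamma> (U\<^sub>m r) (\<rho>\<^sub>m r)) has_real_derivative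
            (\<gamma> - 1) / (4 * (speed (U\<^sub>m r))\<^sup>2) * ((swirl (U\<^sub>m r))\<^sup>2 / r)
            * ((\<gamma> + 1)\<^sup>2 / (\<gamma> - 1 + 2 / mach_sq \<gamma> (U\<^sub>m r) (\<rho>\<^sub>m r))
               - (\<gamma> - 1 + 2 / mach_sq \<gamma> (U\<^sub>m r) (\<rho>\<^sub>m r)))) (at r))"
proof (rule ball_cong[OF refl])
  let ?S = "{0<..<r\<^sub>0}"
  define X where "X = (\<lambda>r. 1 / mach_sq \<gamma> (U\<^sub>m r) (\<rho>\<^sub>m r))"
  have pos: "pressure (U\<^sub>m r) > 0" "\<rho>\<^sub>m r > 0" "speed (U\<^sub>m r) > 0" if "r \<in> ?S" for r
    using assms(5) that unfolding background_state_def by blast+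
  have X: "X r = \<gamma> * pressure (U\<^sub>m r) / (\<rho>\<^sub>m r * (speed (U\<^sub>m r))\<^sup>2)" for r
    by (simp add: X_def mach_sq_def sound_speed_sq_def)
  have Xpos: "X r > 0" if "r \<in> ?S" for r
    using pos[OF that] assms(1) by (simp add: X)
  have mach: "mach_sq \<gamma> (U\<^sub>m r) (\<rho>\<^sub>m r) = 1 / X r" for r
    by (simp add: X_def)
  fix r assume r: "r \<in> ?S"
  define E where "E = (\<gamma> - 1) / (4 * (speed (U\<^sub>m r))\<^sup>2) * ((swirl (U\<^sub>m r))\<^sup>2 / r)
      * ((\<gamma> + 1)\<^sup>2 / (\<gamma> - 1 + 2 * X r) - (\<gamma> - 1 + 2 * X r))"
  have "mu_sq \<gamma> > 0"
    using assms(1) by (simp add: mu_sq_def)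
  then have iff: "((\<lambda>r. pressure (U\<^sub>p r)) has_real_derivative
        ((1 + mu_sq \<gamma>) / X r - mu_sq \<gamma>) * (1 / r * \<rho>\<^sub>m r * (swirl (U\<^sub>m r))\<^sup>2)
          - (1 + mu_sq \<gamma>) * pressure (U\<^sub>m r) * E / (X r)\<^sup>2) (at r)
      \<longleftrightarrow> (X has_real_derivative E) (at r)"
    using assms(9,10) r pos Xpos
    by (intro has_real_derivative_jump_iff[where S = ?S]) (force simp: mach)+
  have q: "speed (U\<^sub>p r) = speed (U\<^sub>m r) * (\<gamma> - 1 + 2 * X r) / (\<gamma> + 1)"
  proof -
    have "sound_speed_sq \<gamma> (U\<^sub>m r) (\<rho>\<^sub>m r) / speed (U\<^sub>m r) = speed (U\<^sub>m r) * X r"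
      using pos[OF r] by (simp add: X sound_speed_sq_def power2_eq_square)
    then have "speed (U\<^sub>p r)
        = mu_sq \<gamma> * (speed (U\<^sub>m r) + 2 / (\<gamma> - 1) * (speed (U\<^sub>m r) * X r))"
      using bspec[OF assms(11) r] by (simp only:)
    also have "\<dots> = speed (U\<^sub>m r) * (\<gamma> - 1 + 2 * X r) / (\<gamma> + 1)"
      using assms(1) by (simp add: mu_sq_def divide_simps) (simp add: algebra_simps)
    finally show ?thesis .
  qed
  have rho: "\<rho>\<^sub>p r = \<rho>\<^sub>m r * (\<gamma> + 1) / (\<gamma> - 1 + 2 * X r)"
    using assms(12) r pos[OF r] by (simp add: q)
  have p: "pressure (U\<^sub>m r) = \<rho>\<^sub>m r * (speed (U\<^sub>m r))\<^sup>2 * X r / \<gamma>"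
    using pos[OF r] assms(1) by (simp add: X)
  have D: "((1 + mu_sq \<gamma>) / X r - mu_sq \<gamma>) * (1 / r * \<rho>\<^sub>m r * (swirl (U\<^sub>m r))\<^sup>2)
        - (1 + mu_sq \<gamma>) * pressure (U\<^sub>m r) * E / (X r)\<^sup>2
      = 1 / r * \<rho>\<^sub>p r * (swirl (U\<^sub>p r))\<^sup>2"
    using jump_derivative_identity[OF assms(1) Xpos[OF r] pos(3)[OF r] p,
        of "(swirl (U\<^sub>m r))\<^sup>2 / r"] assms(13) r
    by (simp add: E_def rho mult_ac)
  show "((\<lambda>r. pressure (U\<^sub>p r)) has_real_derivative
            1 / r * \<rho>\<^sub>p r * (swirl (U\<^sub>p r))\<^sup>2) (at r)
     \<longleftrightarrow> ((\<lambda>r. 1 / mach_sq \<gamma> (U\<^sub>m r) (\<rho>\<^sub>m r)) has_real_derivative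
            (\<gamma> - 1) / (4 * (speed (U\<^sub>m r))\<^sup>2) * ((swirl (U\<^sub>m r))\<^sup>2 / r)
            * ((\<gamma> + 1)\<^sup>2 / (\<gamma> - 1 + 2 / mach_sq \<gamma> (U\<^sub>m r) (\<rho>\<^sub>m r))
               - (\<gamma> - 1 + 2 / mach_sq \<gamma> (U\<^sub>m r) (\<rho>\<^sub>m r)))) (at r)"
    using iff[unfolded D] by (simp add: E_def mach)
qed

end
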